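(* Let $\nabla$ be an $h$-connection of $E$ whose topological holonomy group $G_\nabla$ is contained in $SU(2)$. Then $G_\nabla$ is finite if and only if $\Phi(G_\nabla)$ is finite.
   Context: Let $T^2=S^1\times S^1$ with $S^1=\mathbb{R}/2\pi\mathbb{Z}$ and let $\mathrm{pr}:\mathbb{R}^2\to T^2$ be the projection. $E$ is a complex vector bundle over $T^2$ of (complex) rank 2 with a Hermitian metric $h$; an $h$-connection is a connection $\nabla$ of $E$ with $\nabla h=0$. Let $\tilde v_1,\tilde v_2$ be an orthonormal basis of $\mathrm{pr}^*E_{(0,0)}$, and let $\tilde\xi_{i,x}$ (resp. $\tilde\xi_{i,y}$) be the $\nabla$-parallel sections of $\mathrm{pr}^*E$ along the $x$-axis (resp. $y$-axis) with value $\tilde v_i$ at $(0,0)$. Identifying the fibers of the pull-back at $(x+2\pi m,y+2\pi n)$ and $(x,y)$ for $m,n\in\mathbb{Z}$, there are $B_1,B_2\in U(2)$ with $(\tilde\xi_{1,x}(a+2\pi,0)\ \tilde\xi_{2,x}(a+2\pi,0))=(\tilde\xi_{1,x}(a,0)\ \tilde\xi_{2,x}(a,0))B_1$ and $(\tilde\xi_{1,y}(0,b+2\pi)\ \tilde\xi_{2,y}(0,b+2\pi))=(\tilde\xi_{1,y}(0,b)\ \tilde\xi_{2,y}(0,b))B_2$ for all $a,b\in\mathbb{R}$. The topological holonomy group $G_\nabla$ is the subgroup of $U(2)$ generated by $B_1,B_2$ (determined up to conjugation). $\Phi:SU(2)\to SO(3)$ is the double covering homomorphism given, for real $b_1,\dots,b_4$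 with $b_1^2+b_2^2+b_3^2+b_4^2=1$, by $$\Phi\begin{pmatrix}b_1+\sqrt{-1}b_2&-b_3+\sqrt{-1}b_4\\ b_3+\sqrt{-1}b_4&b_1-\sqrt{-1}b_2\end{pmatrix}=\begin{pmatrix}b_1^2+b_2^2-b_3^2-b_4^2&2b_1b_4+2b_2b_3&-2b_1b_3+2b_2b_4\\ -2b_1b_4+2b_2b_3&b_1^2+b_3^2-b_2^2-b_4^2&2b_1b_2+2b_3b_4\\ 2b_1b_3+2b_2b_4&-2b_1b_2+2b_3b_4&b_1^2+b_4^2-b_2^2-b_3^2\end{pmatrix}.$$ *)

theory Defs
  imports "HOL-Analysis.Analysis" "HOL-Algebra.Generated_Groups"
begin

section \<open>Smooth maps\<close>

text \<open>Used for open \<open>S\<close> only: \<open>f\<close> is of class \<open>C^k\<close> on \<open>S\<close>. Coordinate partial derivatives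
  are taken with respect to the standard basis of the Euclidean space.\<close>

primrec Ck_on :: "nat \<Rightarrow> 'a::euclidean_space set \<Rightarrow> ('a \<Rightarrow> 'b::real_normed_vector) \<Rightarrow> bool" where
  "Ck_on 0 S f \<longleftrightarrow> continuous_on S f"
| "Ck_on (Suc k) S f \<longleftrightarrow>
     f differentiable_on S \<and> (\<forall>i\<in>Basis. Ck_on k S (\<lambda>x. frechet_derivative f (at x) i))"

definition smooth_on :: "'a::euclidean_space set \<Rightarrow> ('a \<Rightarrow> 'b::real_normed_vector) \<Rightarrow> bool" where
  "smooth_on S f \<longleftrightarrow> (\<forall>k. Ck_on k S f)"

section \<open>The torus\<close>

definition circle_rel :: "real \<Rightarrow> real \<Rightarrow> bool" where
  "circle_rel x y \<longleftrightarrow> (\<exists>m::int. y = x + 2 * pi * of_int m)"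

lemma circle_rel_equivp: "equivp circle_rel"
proof (rule equivpI)
  show "reflp circle_rel"
    unfolding reflp_def circle_rel_def by (intro allI exI[of _ 0]) simp
  show "symp circle_rel"
    unfolding symp_def circle_rel_def
  proof (intro allI impI)
    fix x y :: real assume "\<exists>m::int. y = x + 2 * pi * of_int m"
    then obtain m :: int where "y = x + 2 * pi * of_int m" by blast
    then show "\<exists>m::int. x = y + 2 * pi * of_int m" by (intro exI[of _ "- m"]) simp
  qed
  show "transp circle_rel"
    unfolding transp_def circle_rel_def
  proof (intro allI impI)
    fix x y z :: real
    assume "\<exists>m::int. y = x + 2 * pi * of_int m" "\<exists>m::int. z = y + 2 * pi * of_int m"
    then obtain m n :: int where "y = x + 2 * pi * of_int m" "z = y + 2 * pi * of_int n" by blast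
    then show "\<exists>m::int. z = x + 2 * pi * of_int m"
      by (intro exI[of _ "m + n"]) (simp add: algebra_simps)
  qed
qed

quotient_type circle = real / circle_rel
  morphisms rep_circle to_circle
  by (rule circle_rel_equivp)

instantiation circle :: topological_space
begin

definition open_circle :: "circle set \<Rightarrow> bool" where
  "open_circle U \<longleftrightarrow> open (to_circle -` U)"

instance
proof
  show "open (UNIV :: circle set)" by (simp add: open_circle_def)
  show "open (S \<inter> T)" if "open S" "open T" for S T :: "circle set"
    using that by (simp add: open_circle_def open_Int)
  show "open (\<Union>K)" if "\<forall>S\<in>K. open S" for K :: "circle set set"
    using that by (auto simp: open_circle_def vimage_Union)
qed

end

type_synonym torus = "circle \<times> circle"

definition pr :: "real \<times> real \<Rightarrow> torus" where
  "pr q = (to_circle (fst q), to_circle (snd q))"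

lemma pr_eq_iff:
  "pr (x, y) = pr (x', y') \<longleftrightarrow> (\<exists>m n::int. x' = x + 2 * pi * of_int m \<and> y' = y + 2 * pi * of_int n)"
  by (auto simp: pr_def circle.abs_eq_iff circle_rel_def)

text \<open>The smooth structure of the torus is the one for which the covering map \<open>pr\<close> is a local
  diffeomorphism. Its differential identifies every tangent space of the torus with
  \<open>\<real> \<times> \<real>\<close>, and this identification does not depend on the chosen lift of the base point.\<close>

definition torus_smooth_on :: "torus set \<Rightarrow> (torus \<Rightarrow> 'b::real_normed_vector) \<Rightarrow> bool" where
  "torus_smooth_on U f \<longleftrightarrow> smooth_on (pr -` U) (f \<circ> pr)"

section \<open>Complex vector bundles of rank 2 over the torus\<close>

text \<open>The total space is the type \<open>'e\<close>, with projection \<open>proj\<close>. The operations \<open>fadd\<close> and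
  \<open>fscale\<close> are only meaningful for arguments in a common fibre. An element \<open>(U, \<phi>)\<close> of
  \<open>trivs\<close> is a local trivialization over \<open>U\<close>, given by its inverse
  \<open>U \<times> \<complex>^2 \<rightarrow> E\<close>; the values of \<open>\<phi>\<close> outside \<open>U\<close> are irrelevant.\<close>

record 'e vbundle =
  proj :: "'e \<Rightarrow> torus"
  fadd :: "'e \<Rightarrow> 'e \<Rightarrow> 'e"
  fscale :: "complex \<Rightarrow> 'e \<Rightarrow> 'e"
  trivs :: "(torus set \<times> (torus \<Rightarrow> complex^2 \<Rightarrow> 'e)) set"

definition fibre :: "'e vbundle \<Rightarrow> torus \<Rightarrow> 'e set" where
  "fibre E p = {e. proj E e = p}"

text \<open>The vector space laws in the fibres follow, since every fibre is in linear bijection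
  with \<open>\<complex>^2\<close>.\<close>

definition vector_bundle :: "'e vbundle \<Rightarrow> bool" where
  "vector_bundle E \<longleftrightarrow>
     (\<Union>(U, \<phi>)\<in>trivs E. U) = UNIV \<and>
     (\<forall>(U, \<phi>)\<in>trivs E. open U \<and>
        (\<forall>p\<in>U. bij_betw (\<phi> p) UNIV (fibre E p) \<and>
           (\<forall>u v. \<phi> p (u + v) = fadd E (\<phi> p u) (\<phi> p v)) \<and>
           (\<forall>c v. \<phi> p (c *s v) = fscale E c (\<phi> p v)))) \<and>
     (\<forall>(U, \<phi>)\<in>trivs E. \<forall>(V, \<psi>)\<in>trivs E.
        \<exists>g :: torus \<Rightarrow> complex^2^2. torus_smooth_on (U \<inter> V) g \<and>
          (\<forall>p\<in>U \<inter> V. \<forall>v. \<phi> p v = \<psi> p (g p *v v)))"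

definition smooth_section :: "'e vbundle \<Rightarrow> (torus \<Rightarrow> 'e) \<Rightarrow> bool" where
  "smooth_section E s \<longleftrightarrow>
     (\<forall>p. s p \<in> fibre E p) \<and>
     (\<forall>(U, \<phi>)\<in>trivs E. \<exists>f. torus_smooth_on U f \<and> (\<forall>p\<in>U. s p = \<phi> p (f p)))"

text \<open>Hermitian metrics are complex linear in the first and conjugate linear in the second
  argument.\<close>

definition hermitian_metric :: "'e vbundle \<Rightarrow> ('e \<Rightarrow> 'e \<Rightarrow> complex) \<Rightarrow> bool" where
  "hermitian_metric E h \<longleftrightarrow>
     (\<forall>p. \<forall>u\<in>fibre E p. \<forall>v\<in>fibre E p.
        (\<forall>w\<in>fibre E p. h (fadd E u v) w = h u w + h v w) \<and>
        (\<forall>c. h (fscale E c u) v = c * h u v) \<and>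
        h v u = cnj (h u v)) \<and>
     (\<forall>p. \<forall>u\<in>fibre E p. u \<noteq> fscale E 0 u \<longrightarrow> Im (h u u) = 0 \<and> Re (h u u) > 0) \<and>
     (\<forall>(U, \<phi>)\<in>trivs E. \<forall>i j.
        torus_smooth_on U (\<lambda>p. h (\<phi> p (axis i 1)) (\<phi> p (axis j 1))))"

text \<open>A connection maps a smooth section \<open>s\<close> to the \<open>E\<close>-valued 1-form whose value on a tangent
  vector \<open>v\<close> at \<open>p\<close> is \<open>nabla s p v\<close>. In the Leibniz rule, the differential of \<open>f\<close> at \<open>pr q\<close>
  is computed as that of the lift \<open>f \<circ> pr\<close> at \<open>q\<close>.\<close>

type_synonym 'e connection = "(torus \<Rightarrow> 'e) \<Rightarrow> torus \<Rightarrow> real \<times> real \<Rightarrow> 'e"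

definition is_connection :: "'e vbundle \<Rightarrow> 'e connection \<Rightarrow> bool" where
  "is_connection E nabla \<longleftrightarrow>
     (\<forall>s. smooth_section E s \<longrightarrow>
        (\<forall>v. smooth_section E (\<lambda>p. nabla s p v)) \<and>
        (\<forall>p v w. nabla s p (v + w) = fadd E (nabla s p v) (nabla s p w)) \<and>
        (\<forall>p c v. nabla s p (c *\<^sub>R v) = fscale E (of_real c) (nabla s p v))) \<and>
     (\<forall>s t. smooth_section E s \<longrightarrow> smooth_section E t \<longrightarrow>
        (\<forall>p v. nabla (\<lambda>p. fadd E (s p) (t p)) p v = fadd E (nabla s p v) (nabla t p v))) \<and>
     (\<forall>s f. smooth_section E s \<longrightarrow> torus_smooth_on UNIV f \<longrightarrow>
        (\<forall>q v. nabla (\<lambda>p. fscale E (f p) (s p)) (pr q) v =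
           fadd E (fscale E (frechet_derivative (f \<circ> pr) (at q) v) (s (pr q)))
                  (fscale E (f (pr q)) (nabla s (pr q) v))))"

definition is_h_connection :: "'e vbundle \<Rightarrow> ('e \<Rightarrow> 'e \<Rightarrow> complex) \<Rightarrow> 'e connection \<Rightarrow> bool" where
  "is_h_connection E h nabla \<longleftrightarrow>
     is_connection E nabla \<and>
     (\<forall>s t. smooth_section E s \<longrightarrow> smooth_section E t \<longrightarrow>
        (\<forall>q v. frechet_derivative ((\<lambda>p. h (s p) (t p)) \<circ> pr) (at q) v =
           h (nabla s (pr q) v) (t (pr q)) + h (s (pr q)) (nabla t (pr q) v)))"

section \<open>Parallel sections of the pull-back bundle along curves in the plane\<close>

text \<open>The fibre of the pull-back bundle at \<open>q\<close> is \<open>fibre E (pr q)\<close>, so that the fibres at \<open>q\<close> and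
  at its translates by \<open>2 \<pi> \<int>^2\<close> are literally the same set.\<close>

definition smooth_section_along :: "'e vbundle \<Rightarrow> (real \<Rightarrow> real \<times> real) \<Rightarrow> (real \<Rightarrow> 'e) \<Rightarrow> bool" where
  "smooth_section_along E \<gamma> \<xi> \<longleftrightarrow>
     (\<forall>t. \<xi> t \<in> fibre E (pr (\<gamma> t))) \<and>
     (\<forall>(U, \<phi>)\<in>trivs E. \<exists>f. smooth_on {t. pr (\<gamma> t) \<in> U} f \<and>
        (\<forall>t. pr (\<gamma> t) \<in> U \<longrightarrow> \<xi> t = \<phi> (pr (\<gamma> t)) (f t)))"

text \<open>The characterizing properties of the covariant derivative along \<open>\<gamma>\<close>, i.e. of the
  pull-back of the connection to the sections along \<open>\<gamma>\<close>. They determine the operator on smooth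
  sections uniquely.\<close>

definition covariant_derivative_along ::
    "'e vbundle \<Rightarrow> 'e connection \<Rightarrow> (real \<Rightarrow> real \<times> real) \<Rightarrow> ((real \<Rightarrow> 'e) \<Rightarrow> real \<Rightarrow> 'e) \<Rightarrow> bool" where
  "covariant_derivative_along E nabla \<gamma> D \<longleftrightarrow>
     (\<forall>\<xi>. smooth_section_along E \<gamma> \<xi> \<longrightarrow> smooth_section_along E \<gamma> (D \<xi>)) \<and>
     (\<forall>\<xi> \<eta>. smooth_section_along E \<gamma> \<xi> \<longrightarrow> smooth_section_along E \<gamma> \<eta> \<longrightarrow>
        (\<forall>t. D (\<lambda>t. fadd E (\<xi> t) (\<eta> t)) t = fadd E (D \<xi> t) (D \<eta> t))) \<and>
     (\<forall>\<xi> f. smooth_section_along E \<gamma> \<xi> \<longrightarrow> smooth_on UNIV f \<longrightarrow>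
        (\<forall>t. D (\<lambda>t. fscale E (f t) (\<xi> t)) t =
           fadd E (fscale E (vector_derivative f (at t)) (\<xi> t)) (fscale E (f t) (D \<xi> t)))) \<and>
     (\<forall>s. smooth_section E s \<longrightarrow>
        (\<forall>t. D (\<lambda>t. s (pr (\<gamma> t))) t = nabla s (pr (\<gamma> t)) (vector_derivative \<gamma> (at t))))"

definition parallel_along ::
    "'e vbundle \<Rightarrow> 'e connection \<Rightarrow> (real \<Rightarrow> real \<times> real) \<Rightarrow> (real \<Rightarrow> 'e) \<Rightarrow> bool" where
  "parallel_along E nabla \<gamma> \<xi> \<longleftrightarrow>
     smooth_section_along E \<gamma> \<xi> \<and>
     (\<exists>D. covariant_derivative_along E nabla \<gamma> D \<and> (\<forall>t. D \<xi> t = fscale E 0 (\<xi> t)))"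

section \<open>Topological holonomy groups\<close>

definition adjoint_matrix :: "complex^2^2 \<Rightarrow> complex^2^2" where
  "adjoint_matrix A = (\<chi> i j. cnj (A $ j $ i))"

definition U2 :: "(complex^2^2) monoid" where
  "U2 = \<lparr>carrier = {A. adjoint_matrix A ** A = mat 1}, monoid.mult = (**), one = mat 1\<rparr>"

definition SU2 :: "(complex^2^2) set" where
  "SU2 = {A \<in> carrier U2. det A = 1}"

lemma adjoint_matrix_mult: "adjoint_matrix (A ** B) = adjoint_matrix B ** adjoint_matrix A"
  by (simp add: adjoint_matrix_def matrix_matrix_mult_def vec_eq_iff mult.commute)

lemma adjoint_matrix_adjoint_matrix: "adjoint_matrix (adjoint_matrix A) = A"
  by (simp add: adjoint_matrix_def vec_eq_iff)

lemma group_U2: "group U2"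
proof (rule groupI)
  show "\<one>\<^bsub>U2\<^esub> \<in> carrier U2"
    by (auto simp: U2_def adjoint_matrix_def matrix_matrix_mult_def vec_eq_iff mat_def sum_2 forall_2)
  show "x \<otimes>\<^bsub>U2\<^esub> y \<in> carrier U2" if "x \<in> carrier U2" "y \<in> carrier U2" for x y
  proof -
    have "adjoint_matrix (x ** y) ** (x ** y) = adjoint_matrix y ** (adjoint_matrix x ** x) ** y"
      by (simp add: adjoint_matrix_mult matrix_mul_assoc)
    with that show ?thesis by (simp add: U2_def)
  qed
  show "\<exists>y\<in>carrier U2. y \<otimes>\<^bsub>U2\<^esub> x = \<one>\<^bsub>U2\<^esub>" if "x \<in> carrier U2" for x
    using that
    by (intro bexI[of _ "adjoint_matrix x"])
       (simp_all add: U2_def adjoint_matrix_adjoint_matrix matrix_left_right_inverse)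
qed (simp_all add: U2_def matrix_mul_assoc)

text \<open>In column \<open>j\<close>, the identity \<open>(\<xi>\<^sub>1(t + 2\<pi>) \<xi>\<^sub>2(t + 2\<pi>)) = (\<xi>\<^sub>1(t) \<xi>\<^sub>2(t)) B\<close>.\<close>

definition monodromy :: "'e vbundle \<Rightarrow> (2 \<Rightarrow> real \<Rightarrow> 'e) \<Rightarrow> complex^2^2 \<Rightarrow> bool" where
  "monodromy E \<xi> B \<longleftrightarrow>
     (\<forall>t j. \<xi> j (t + 2 * pi) = fadd E (fscale E (B $ 1 $ j) (\<xi> 1 t)) (fscale E (B $ 2 $ j) (\<xi> 2 t)))"

text \<open>Two orthonormal vectors form an orthonormal basis, as the fibres have complex dimension 2.\<close>

definition orthonormal_basis :: "'e vbundle \<Rightarrow> ('e \<Rightarrow> 'e \<Rightarrow> complex) \<Rightarrow> torus \<Rightarrow> (2 \<Rightarrow> 'e) \<Rightarrow> bool" where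
  "orthonormal_basis E h p v \<longleftrightarrow>
     (\<forall>i. v i \<in> fibre E p) \<and> (\<forall>i j. h (v i) (v j) = (if i = j then 1 else 0))"

definition holonomy_matrices ::
    "'e vbundle \<Rightarrow> ('e \<Rightarrow> 'e \<Rightarrow> complex) \<Rightarrow> 'e connection \<Rightarrow> complex^2^2 \<Rightarrow> complex^2^2 \<Rightarrow> bool" where
  "holonomy_matrices E h nabla B\<^sub>1 B\<^sub>2 \<longleftrightarrow>
     B\<^sub>1 \<in> carrier U2 \<and> B\<^sub>2 \<in> carrier U2 \<and>
     (\<exists>v \<xi>x \<xi>y. orthonormal_basis E h (pr (0, 0)) v \<and>
        (\<forall>i. parallel_along E nabla (\<lambda>x. (x, 0)) (\<xi>x i) \<and> \<xi>x i 0 = v i) \<and>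
        (\<forall>i. parallel_along E nabla (\<lambda>y. (0, y)) (\<xi>y i) \<and> \<xi>y i 0 = v i) \<and>
        monodromy E \<xi>x B\<^sub>1 \<and> monodromy E \<xi>y B\<^sub>2)"

text \<open>The group depends on the choice of the orthonormal basis, which conjugates it in \<open>U(2)\<close>;
  hence a predicate rather than a function.\<close>

definition topological_holonomy_group ::
    "'e vbundle \<Rightarrow> ('e \<Rightarrow> 'e \<Rightarrow> complex) \<Rightarrow> 'e connection \<Rightarrow> (complex^2^2) set \<Rightarrow> bool" where
  "topological_holonomy_group E h nabla G \<longleftrightarrow>
     (\<exists>B\<^sub>1 B\<^sub>2. holonomy_matrices E h nabla B\<^sub>1 B\<^sub>2 \<and> G = generate U2 {B\<^sub>1, B\<^sub>2})"

section \<open>The double covering of SO(3) by SU(2)\<close>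

definition SU2_matrix :: "real \<Rightarrow> real \<Rightarrow> real \<Rightarrow> real \<Rightarrow> complex^2^2" where
  "SU2_matrix b\<^sub>1 b\<^sub>2 b\<^sub>3 b\<^sub>4 =
     vector [vector [of_real b\<^sub>1 + \<i> * of_real b\<^sub>2, - of_real b\<^sub>3 + \<i> * of_real b\<^sub>4],
             vector [of_real b\<^sub>3 + \<i> * of_real b\<^sub>4, of_real b\<^sub>1 - \<i> * of_real b\<^sub>2]]"

definition SO3_matrix :: "real \<Rightarrow> real \<Rightarrow> real \<Rightarrow> real \<Rightarrow> real^3^3" where
  "SO3_matrix b\<^sub>1 b\<^sub>2 b\<^sub>3 b\<^sub>4 =
     vector [vector [b\<^sub>1^2 + b\<^sub>2^2 - b\<^sub>3^2 - b\<^sub>4^2, 2*b\<^sub>1*b\<^sub>4 + 2*b\<^sub>2*b\<^sub>3, -2*b\<^sub>1*b\<^sub>3 + 2*b\<^sub>2*b\<^sub>4],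
             vector [-2*b\<^sub>1*b\<^sub>4 + 2*b\<^sub>2*b\<^sub>3, b\<^sub>1^2 + b\<^sub>3^2 - b\<^sub>2^2 - b\<^sub>4^2, 2*b\<^sub>1*b\<^sub>2 + 2*b\<^sub>3*b\<^sub>4],
             vector [2*b\<^sub>1*b\<^sub>3 + 2*b\<^sub>2*b\<^sub>4, -2*b\<^sub>1*b\<^sub>2 + 2*b\<^sub>3*b\<^sub>4, b\<^sub>1^2 + b\<^sub>4^2 - b\<^sub>2^2 - b\<^sub>3^2]]"

text \<open>Only the values on \<open>SU2\<close> matter; there the parameters are read off from the first column,
  see \<open>Phi_SU2_matrix\<close> and \<open>SU2_eq\<close>.\<close>

definition Phi :: "complex^2^2 \<Rightarrow> real^3^3" where
  "Phi A = SO3_matrix (Re (A $ 1 $ 1)) (Im (A $ 1 $ 1)) (Re (A $ 2 $ 1)) (Im (A $ 2 $ 1))"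

lemma Phi_SU2_matrix: "Phi (SU2_matrix b\<^sub>1 b\<^sub>2 b\<^sub>3 b\<^sub>4) = SO3_matrix b\<^sub>1 b\<^sub>2 b\<^sub>3 b\<^sub>4"
  by (simp add: Phi_def SU2_matrix_def vector_2)

lemma SU2_eq: "SU2 = {SU2_matrix b\<^sub>1 b\<^sub>2 b\<^sub>3 b\<^sub>4 | b\<^sub>1 b\<^sub>2 b\<^sub>3 b\<^sub>4. b\<^sub>1^2 + b\<^sub>2^2 + b\<^sub>3^2 + b\<^sub>4^2 = 1}"
proof (intro equalityI subsetI)
  fix A assume "A \<in> SU2"
  define a b c d where "a = A $ 1 $ 1" and "b = A $ 1 $ 2" and "c = A $ 2 $ 1" and "d = A $ 2 $ 2"
  note abcd = a_def b_def c_def d_def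
  have 1: "cnj a * a + cnj c * c = 1" "cnj a * b + cnj c * d = 0" "a * d - b * c = 1"
    using \<open>A \<in> SU2\<close>
    by (auto simp: SU2_def U2_def adjoint_matrix_def matrix_matrix_mult_def vec_eq_iff mat_def
        sum_2 forall_2 det_2 abcd)
  have d: "d = cnj a"
  proof -
    have "d = (cnj a * a + cnj c * c) * d" using 1 by simp
    also have "\<dots> = cnj a * (a * d - b * c) + c * (cnj a * b + cnj c * d)"
      by (simp add: algebra_simps)
    finally show ?thesis using 1 by simp
  qed
  have b: "b = - cnj c"
  proof -
    have "b = (cnj a * a + cnj c * c) * b" using 1 by simp
    also have "\<dots> = a * (cnj a * b + cnj c * d) - cnj c * (a * d - b * c)"
      by (simp add: algebra_simps)
    finally show ?thesis using 1 by simp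
  qed
  have "A = SU2_matrix (Re a) (Im a) (Re c) (Im c)"
    using b d by (simp add: SU2_matrix_def vec_eq_iff forall_2 vector_2 abcd complex_eq_iff)
  moreover have "(Re a)^2 + (Im a)^2 + (Re c)^2 + (Im c)^2 = 1"
    using arg_cong[OF 1(1), of Re] by (simp add: power2_eq_square)
  ultimately show "A \<in> {SU2_matrix b\<^sub>1 b\<^sub>2 b\<^sub>3 b\<^sub>4 | b\<^sub>1 b\<^sub>2 b\<^sub>3 b\<^sub>4. b\<^sub>1^2 + b\<^sub>2^2 + b\<^sub>3^2 + b\<^sub>4^2 = 1}"
    by blast
next
  fix A assume "A \<in> {SU2_matrix b\<^sub>1 b\<^sub>2 b\<^sub>3 b\<^sub>4 | b\<^sub>1 b\<^sub>2 b\<^sub>3 b\<^sub>4. b\<^sub>1^2 + b\<^sub>2^2 + b\<^sub>3^2 + b\<^sub>4^2 = 1}"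
  then show "A \<in> SU2"
    by (auto simp: SU2_def U2_def SU2_matrix_def adjoint_matrix_def matrix_matrix_mult_def
        vec_eq_iff mat_def sum_2 forall_2 det_2 vector_2 complex_eq_iff power2_eq_square algebra_simps)
qed

end

theory Submission
  imports Defs
begin

text \<open>
  Being a double covering, \<open>Phi\<close> has fibres of at most two elements on \<open>SU2\<close>
  (\<open>Phi_eq_imp_eq_or_uminus\<close>), so any subset of \<open>SU2\<close> is finite as soon as its image is.
  In particular this holds for the holonomy group.

  The fibres are found without the homomorphism property of \<open>Phi\<close>. On a unit vector
  \<open>b = (b\<^sub>1, b\<^sub>2, b\<^sub>3, b\<^sub>4)\<close>, the entries of the rotation matrix together with \<open>|b|\<^sup>2 = 1\<close>
  determine all products \<open>b\<^sub>i b\<^sub>j\<close>, that is, the orthogonal projection onto the line spanned by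
  \<open>b\<close>, and the only unit vectors on that line are \<open>b\<close> and \<open>- b\<close>.
\<close>

text \<open>The off-diagonal products come from sums and differences of entries in transposed positions,
  the squares from combining the diagonal entries with the equation of the sphere.\<close>

lemma SO3_matrix_eq_imp_products_eq:
  assumes "SO3_matrix a b c d = SO3_matrix a' b' c' d'"
    and "a^2 + b^2 + c^2 + d^2 = 1" "a'^2 + b'^2 + c'^2 + d'^2 = 1"
  shows "a^2 = a'^2" "b^2 = b'^2" "c^2 = c'^2" "d^2 = d'^2"
    and "a * b = a' * b'" "a * c = a' * c'" "a * d = a' * d'"
    and "b * c = b' * c'" "b * d = b' * d'" "c * d = c' * d'"
  using assms by (simp_all add: SO3_matrix_def vec_eq_iff forall_3 vector_3)

lemma SO3_matrix_eq_imp_eq_or_neg: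
  assumes "SO3_matrix a b c d = SO3_matrix a' b' c' d'"
    and unit: "a^2 + b^2 + c^2 + d^2 = 1" and unit': "a'^2 + b'^2 + c'^2 + d'^2 = 1"
  shows "(a, b, c, d) = (a', b', c', d') \<or> (a, b, c, d) = (- a', - b', - c', - d')"
proof -
  note products = SO3_matrix_eq_imp_products_eq[OF assms]
  define s where "s = a * a' + b * b' + c * c' + d * d'"
  \<comment> \<open>Every term \<open>(b\<^sub>i b\<^sub>j) (b'\<^sub>i b'\<^sub>j)\<close> of \<open>s\<^sup>2\<close> equals \<open>b\<^sub>i\<^sup>2 b\<^sub>j\<^sup>2\<close>: this is the case of
    equality in the Cauchy-Schwarz inequality.\<close>
  have "s^2 = a^2 * a'^2 + b^2 * b'^2 + c^2 * c'^2 + d^2 * d'^2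
      + 2 * ((a * b) * (a' * b') + (a * c) * (a' * c') + (a * d) * (a' * d')
           + (b * c) * (b' * c') + (b * d) * (b' * d') + (c * d) * (c' * d'))"
    by (simp add: s_def power2_eq_square algebra_simps)
  also have "\<dots> = (a^2 + b^2 + c^2 + d^2)^2"
    unfolding products[symmetric] by (simp add: power2_eq_square algebra_simps)
  finally have "s^2 = 1"
    using unit by simp
  then consider "s = 1" | "s = - 1"
    using power2_eq_1_iff by blast
  then show ?thesis
  proof cases
    case 1
    have "(a - a')^2 + (b - b')^2 + (c - c')^2 + (d - d')^2 = 2 - 2 * s"
      using unit unit' by (simp add: s_def power2_diff)
    then have "(a - a')^2 + (b - b')^2 + (c - c')^2 + (d - d')^2 = 0"
      using 1 by simp
    then show ?thesis
      by (simp add: add_nonneg_eq_0_iff)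
  next
    case 2
    have "(a + a')^2 + (b + b')^2 + (c + c')^2 + (d + d')^2 = 2 + 2 * s"
      using unit unit' by (simp add: s_def power2_sum)
    then have "(a + a')^2 + (b + b')^2 + (c + c')^2 + (d + d')^2 = 0"
      using 2 by simp
    then show ?thesis
      by (simp add: add_nonneg_eq_0_iff eq_neg_iff_add_eq_0)
  qed
qed

lemma uminus_SU2_matrix: "- SU2_matrix a b c d = SU2_matrix (- a) (- b) (- c) (- d)"
  by (simp add: SU2_matrix_def vec_eq_iff forall_2 vector_2)

lemma Phi_eq_imp_eq_or_uminus:
  assumes "A \<in> SU2" "B \<in> SU2" "Phi A = Phi B"
  shows "A = B \<or> A = - B"
proof -
  obtain a b c d where A: "A = SU2_matrix a b c d" "a^2 + b^2 + c^2 + d^2 = 1"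
    using assms(1) by (auto simp: SU2_eq)
  obtain a' b' c' d' where B: "B = SU2_matrix a' b' c' d'" "a'^2 + b'^2 + c'^2 + d'^2 = 1"
    using assms(2) by (auto simp: SU2_eq)
  have "SO3_matrix a b c d = SO3_matrix a' b' c' d'"
    using assms(3) by (simp add: A B Phi_SU2_matrix)
  from SO3_matrix_eq_imp_eq_or_neg[OF this A(2) B(2)] show ?thesis
    by (auto simp: A(1) B(1) uminus_SU2_matrix)
qed

lemma finite_Phi_image_iff:
  assumes "S \<subseteq> SU2"
  shows "finite (Phi ` S) \<longleftrightarrow> finite S"
proof
  assume "finite (Phi ` S)"
  have "finite (Phi -` {Phi A} \<inter> S)" if "A \<in> S" for A
  proof (rule finite_subset)
    show "Phi -` {Phi A} \<inter> S \<subseteq> {A, - A}"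
      using Phi_eq_imp_eq_or_uminus that assms by blast
  qed simp
  with \<open>finite (Phi ` S)\<close> show "finite S"
    using inf_img_fin_dom'[of Phi S] by auto
qed simp

theorem proposition8p2:
  fixes E :: "'e vbundle"
    and h :: "'e \<Rightarrow> 'e \<Rightarrow> complex"
    and nabla :: "'e connection"
    and G :: "(complex^2^2) set"
  assumes "vector_bundle E"
    and "hermitian_metric E h"
    and "is_h_connection E h nabla"
    and "topological_holonomy_group E h nabla G"
    and "G \<subseteq> SU2"
  shows "finite G \<longleftrightarrow> finite (Phi ` G)"
  using finite_Phi_image_iff[OF \<open>G \<subseteq> SU2\<close>] by simp

end
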